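(* For $0\le\gamma<1$ let $C_\gamma=\sum_{j=2}^\infty\gamma^{j-2}/j$ (which equals $-\{\gamma+\log(1-\gamma)\}/\gamma^2$ for $\gamma>0$, and $1/2$ for $\gamma=0$). Let $\{\mathcal{F}_n,n\ge0\}$ be an increasing sequence of $\sigma$-fields and let $Y_n$ $(n\ge1)$ be $\mathcal{F}_n$-measurable random variables. Let $0\le\gamma_n<1$ and $0<\lambda_n\le1/C_{\gamma_n}$ be $\mathcal{F}_{n-1}$-measurable random variables. Let $\mu_n=E\{Y_n\mathbb{1}(-\gamma_n\le Y_n<\lambda_n)\mid\mathcal{F}_{n-1}\}$. Then $$\exp\Big\{\sum_{i=1}^n(Y_i-\mu_i-\lambda_i^{-1}Y_i^2)\Big\},\qquad n\ge1,$$ is a supermartingale (with respect to $\{\mathcal{F}_n\}$) whose expectation is $\le1$.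
   Context: $\mathbb{1}(\cdot)$ is an indicator with the convention $0^0=1$ in the series for $C_0$. No integrability of the $Y_n$ is assumed. *)

theory Defs
  imports "HOL-Probability.Probability"
begin

text \<open>
  The series \<open>\<Sum>j\<ge>2. g^(j-2) / j\<close>, reindexed by \<open>j = k + 2\<close>; the convention
  \<open>0^0 = 1\<close> is that of the library power. It converges for \<open>0 \<le> g < 1\<close>.
\<close>
definition C_const :: "real \<Rightarrow> real" where
  "C_const g = (\<Sum>k. g ^ k / real (k + 2))"

text \<open>
  Supermartingale with time set \<open>I\<close>. The filtration may be indexed by more times than \<open>I\<close>.
  Integrability is an explicit clause because the Bochner integral, and hence
  \<^const>\<open>real_cond_exp\<close>, carries no information for a non-integrable function.
\<close>
definition supermartingale_on ::
  "nat set \<Rightarrow> 'a measure \<Rightarrow> (nat \<Rightarrow> 'a measure) \<Rightarrow> (nat \<Rightarrow> 'a \<Rightarrow> real) \<Rightarrow> bool" where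
  "supermartingale_on I M F X \<longleftrightarrow>
     filtration (space M) F \<and>
     (\<forall>n. subalgebra M (F n)) \<and>
     (\<forall>n\<in>I. X n \<in> borel_measurable (F n)) \<and>
     (\<forall>n\<in>I. integrable M (X n)) \<and>
     (\<forall>m\<in>I. \<forall>n\<in>I. m \<le> n \<longrightarrow> (AE x in M. real_cond_exp M (F m) (X n) x \<le> X m x))"

end

theory Submission
  imports Defs
begin

text \<open>
  The key is the elementary inequality
  \<open>exp (y - y\<^sup>2 / l) \<le> 1 + y * 1(-g \<le> y < l)\<close>, valid for all real \<open>y\<close> whenever
  \<open>0 < l \<le> 1 / C_g\<close> (lemma \<open>exp_minus_square_le_truncation\<close>). Outside the window
  \<open>[-g, l)\<close> the exponent is nonpositive. Inside it, the claim is
  \<open>ln (1 + y) \<ge> y - y\<^sup>2 / l\<close>: on the negative side the Taylor series gives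
  \<open>ln (1 - t) = -t - t\<^sup>2 * C_t\<close>, so \<open>C_g\<close> is the smallest coefficient that works on all
  of \<open>[-g, 0]\<close> when \<open>g > 0\<close>; on the positive side the coefficient \<open>1/2 = C_0 \<le> C_g\<close> suffices.

  Taking conditional expectations turns the right-hand side into \<open>1 + \<mu> \<le> exp \<mu>\<close>, so that each
  factor \<open>exp (Y - \<mu> - Y\<^sup>2 / \<lambda>)\<close> has conditional expectation at most \<open>1\<close>
  (lemma \<open>cond_exp_compensated_factor_le_1\<close>). Integrability is automatic: since
  \<open>\<lambda> \<le> 1 / C_0 = 2\<close>, the truncated variable lies in \<open>[-1, 2]\<close>, hence so does \<open>\<mu>\<close>, and every
  factor is almost surely bounded by \<open>3 * exp 1\<close>. The partial products are therefore bounded,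
  integrable, and form a supermartingale already when started from the empty product at time
  \<open>0\<close>; that is why the expectations are at most \<open>1\<close>.
\<close>

section \<open>The constant and the pointwise inequality\<close>

text \<open>
  This is the Taylor series of \<open>ln (1 - g)\<close>, with its first two terms dropped and divided by
  \<open>- g\<^sup>2\<close>.
\<close>
lemma C_const_series_sums:
  fixes g :: real
  assumes "0 \<le> g" "g < 1"
  shows "(\<lambda>k. g ^ k / real (k + 2)) sums
    (if g = 0 then 1 / 2 else - (g + ln (1 - g)) / g\<^sup>2)"
proof (cases "g = 0")
  case True
  have "(\<lambda>k. (1 / real (k + 2)) * 0 ^ k) sums (1 / real (0 + 2))"
    by (rule powser_sums_zero)
  with True show ?thesis
    by simp
next
  case False
  have "(\<lambda>n. - (g ^ n) / real n) sums ln (1 - g)"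
    using ln_series'[of "- g"] assms by simp
  from sums_split_initial_segment[OF this, of 2]
  have "(\<lambda>k. - (g ^ (k + 2)) / real (k + 2)) sums (ln (1 - g) + g)"
    by (simp add: numeral_2_eq_2)
  from sums_mult[OF this, of "- 1 / g\<^sup>2"]
  have "(\<lambda>k. - 1 / g\<^sup>2 * (- (g ^ (k + 2)) / real (k + 2))) sums (- 1 / g\<^sup>2 * (ln (1 - g) + g))" .
  moreover have "- 1 / g\<^sup>2 * (- (g ^ (k + 2)) / real (k + 2)) = g ^ k / real (k + 2)" for k
    using False by (simp add: power_add power2_eq_square)
  moreover have "- 1 / g\<^sup>2 * (ln (1 - g) + g) = - (g + ln (1 - g)) / g\<^sup>2"
    using False by (simp add: field_simps)
  ultimately show ?thesis
    using False by simp
qed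

lemma C_const_closed_form:
  assumes "0 \<le> g" "g < 1"
  shows "C_const g = (if g = 0 then 1 / 2 else - (g + ln (1 - g)) / g\<^sup>2)"
  unfolding C_const_def using sums_unique[OF C_const_series_sums[OF assms]] by simp

lemma C_const_mono:
  assumes "0 \<le> s" "s \<le> t" "t < 1"
  shows "C_const s \<le> C_const t"
  unfolding C_const_def
proof (rule suminf_le)
  show "s ^ k / real (k + 2) \<le> t ^ k / real (k + 2)" for k
    using assms by (intro divide_right_mono power_mono) auto
  show "summable (\<lambda>k. s ^ k / real (k + 2))" "summable (\<lambda>k. t ^ k / real (k + 2))"
    by (rule sums_summable[OF C_const_series_sums]; use assms in linarith)+
qed

lemma C_const_ge_half:
  assumes "0 \<le> g" "g < 1"
  shows "1 / 2 \<le> C_const g"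
  using C_const_mono[of 0 g] assms by (simp add: C_const_closed_form)

lemma ln_one_plus_ge_quadratic:
  fixes y :: real
  assumes "0 \<le> y"
  shows "y - y\<^sup>2 / 2 \<le> ln (1 + y)"
proof -
  let ?f = "\<lambda>u::real. ln (1 + u) - u + u\<^sup>2 / 2"
  have "?f 0 \<le> ?f y"
  proof (rule DERIV_nonneg_imp_nondecreasing[OF assms])
    fix u :: real
    assume "0 \<le> u" "u \<le> y"
    then have "(?f has_real_derivative u\<^sup>2 / (1 + u)) (at u)"
      by (auto intro!: derivative_eq_intros simp: divide_simps power2_eq_square algebra_simps)
    moreover have "0 \<le> u\<^sup>2 / (1 + u)"
      using \<open>0 \<le> u\<close> by simp
    ultimately show "\<exists>d. (?f has_real_derivative d) (at u) \<and> 0 \<le> d"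
      by blast
  qed
  then show ?thesis
    by simp
qed

text \<open>
  For \<open>y = -t\<close> with \<open>0 \<le> t \<le> g\<close> this is \<open>ln (1 - t) = -t - t\<^sup>2 * C_t\<close> together with the
  monotonicity of \<open>C\<close>; for \<open>y \<ge> 0\<close> it is weaker than the second-order Taylor bound because
  \<open>C_g \<ge> 1/2\<close>.
\<close>
lemma ln_one_plus_ge_C_const:
  assumes "0 \<le> g" "g < 1" "- g \<le> y"
  shows "y - C_const g * y\<^sup>2 \<le> ln (1 + y)"
proof (cases "0 \<le> y")
  case True
  have "1 / 2 * y\<^sup>2 \<le> C_const g * y\<^sup>2"
    using C_const_ge_half[OF assms(1,2)] by (rule mult_right_mono) simp
  with ln_one_plus_ge_quadratic[OF True] show ?thesis
    by simp
next
  case False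
  then have "C_const (- y) * y\<^sup>2 = y - ln (1 + y)"
    using assms by (simp add: C_const_closed_form)
  moreover have "C_const (- y) * y\<^sup>2 \<le> C_const g * y\<^sup>2"
    using False assms by (intro mult_right_mono C_const_mono) auto
  ultimately show ?thesis
    by simp
qed

lemma exp_minus_square_le_truncation:
  assumes g: "0 \<le> g" "g < 1" and l: "0 < l" "l \<le> 1 / C_const g"
  shows "exp (y - inverse l * y\<^sup>2) \<le> 1 + (if - g \<le> y \<and> y < l then y else 0)"
proof (cases "- g \<le> y \<and> y < l")
  case True
  have C: "C_const g > 0"
    using C_const_ge_half[OF g] by simp
  then have "C_const g \<le> inverse l"
    using l by (simp add: field_simps)
  then have "y - inverse l * y\<^sup>2 \<le> y - C_const g * y\<^sup>2"
    by (simp add: mult_right_mono)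
  also have "\<dots> \<le> ln (1 + y)"
    using g True by (intro ln_one_plus_ge_C_const) auto
  finally have "exp (y - inverse l * y\<^sup>2) \<le> exp (ln (1 + y))"
    by simp
  then show ?thesis
    using g True by simp
next
  case False
  have "y * l \<le> y\<^sup>2"
  proof (cases "y \<le> 0")
    case True
    then have "y * l \<le> 0"
      using l by (simp add: mult_le_0_iff)
    then show ?thesis
      by (rule order_trans) simp
  next
    case nonpos: False
    then have "l \<le> y"
      using False g by auto
    then show ?thesis
      using nonpos by (simp add: power2_eq_square)
  qed
  then have "y - inverse l * y\<^sup>2 \<le> 0"
    using l by (simp add: field_simps)
  with False show ?thesis
    by auto
qed

section \<open>One conditional step\<close>

text \<open>
  Write \<open>T\<close> for the truncated variable, so that \<open>m\<close> is its conditional expectation. The factor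
  splits as \<open>exp (- m)\<close>, which is \<open>G\<close>-measurable and can be pulled out, times
  \<open>exp (Y - Y\<^sup>2 / l) \<le> 1 + T\<close>. From \<open>-1 \<le> T \<le> 2\<close> one gets \<open>exp (- m) \<le> exp 1\<close> almost surely and
  \<open>1 + T \<le> 3\<close>, hence the first bound; the second is \<open>exp (- m) * (1 + m) \<le> 1\<close>. The first bound
  is what makes products of such factors integrable.
\<close>
lemma cond_exp_compensated_factor_le_1:
  fixes Y g l m :: "'a \<Rightarrow> real"
  assumes "prob_space M" and G: "subalgebra M G"
    and Y [measurable]: "Y \<in> borel_measurable M"
    and g_meas: "g \<in> borel_measurable G" and l_meas: "l \<in> borel_measurable G"
    and m_meas: "m \<in> borel_measurable G"
    and g: "\<And>x. x \<in> space M \<Longrightarrow> 0 \<le> g x \<and> g x < 1"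
    and l: "\<And>x. x \<in> space M \<Longrightarrow> 0 < l x \<and> l x \<le> 1 / C_const (g x)"
    and m: "AE x in M. m x =
      real_cond_exp M G (\<lambda>y. Y y * indicator {z. - g z \<le> Y z \<and> Y z < l z} y) x"
  shows "AE x in M. exp (Y x - m x - inverse (l x) * (Y x)\<^sup>2) \<le> 3 * exp 1"
    and "AE x in M.
      real_cond_exp M G (\<lambda>x. exp (Y x - m x - inverse (l x) * (Y x)\<^sup>2)) x \<le> 1"
proof -
  interpret prob_space M by fact
  interpret finite_measure_subalgebra M G
    by unfold_locales (fact G)
  note [measurable] = measurable_from_subalg[OF G g_meas] measurable_from_subalg[OF G l_meas]
    measurable_from_subalg[OF G m_meas]
  define T where "T y = (if - g y \<le> Y y \<and> Y y < l y then Y y else 0)" for y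
  define V where "V x = exp (Y x - inverse (l x) * (Y x)\<^sup>2)" for x
  have T_eq: "(\<lambda>y. Y y * indicator {z. - g z \<le> Y z \<and> Y z < l z} y) = T"
    by (auto simp: T_def indicator_def)
  have [measurable]: "T \<in> borel_measurable M" "V \<in> borel_measurable M"
    unfolding T_def V_def by measurable
  have l_le: "l x \<le> 2" if "x \<in> space M" for x
  proof -
    have "1 / 2 \<le> C_const (g x)"
      using g[OF that] by (intro C_const_ge_half) auto
    then have "1 / C_const (g x) \<le> 2"
      by (simp add: divide_simps)
    then show ?thesis
      using l[OF that] by simp
  qed
  have T_bd: "-1 \<le> T x" "T x \<le> 2" if "x \<in> space M" for x
    using g[OF that] l_le[OF that] l[OF that] by (auto simp: T_def)
  have V_le: "V x \<le> 1 + T x" if "x \<in> space M" for x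
    unfolding V_def T_def using g[OF that] l[OF that] by (intro exp_minus_square_le_truncation) auto
  have int_T: "integrable M T"
  proof (rule integrable_const_bound[where B = 2])
    have "norm (T x) \<le> 2" if "x \<in> space M" for x
      using T_bd[OF that] by simp
    then show "AE x in M. norm (T x) \<le> 2"
      by (rule AE_I2)
  qed simp
  have int_V: "integrable M V"
  proof (rule integrable_const_bound[where B = 3])
    have "norm (V x) \<le> 3" if "x \<in> space M" for x
      using T_bd[OF that] V_le[OF that] by (simp add: V_def)
    then show "AE x in M. norm (V x) \<le> 3"
      by (rule AE_I2)
  qed simp
  have m_T: "AE x in M. m x = real_cond_exp M G T x"
    using m unfolding T_eq .
  have "AE x in M. -1 \<le> real_cond_exp M G T x"
    using T_bd by (intro real_cond_exp_ge_c int_T) auto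
  with m_T have m_ge: "AE x in M. -1 \<le> m x"
    by eventually_elim simp
  have W_eq: "exp (Y x - m x - inverse (l x) * (Y x)\<^sup>2) = exp (- m x) * V x" for x
    by (simp add: V_def flip: exp_add)
  show W_le: "AE x in M. exp (Y x - m x - inverse (l x) * (Y x)\<^sup>2) \<le> 3 * exp 1"
    using m_ge AE_space
  proof eventually_elim
    case (elim x)
    then have "V x \<le> 3"
      using V_le[of x] T_bd[of x] by simp
    moreover have "exp (- m x) \<le> exp 1"
      using elim by simp
    ultimately have "exp (- m x) * V x \<le> exp 1 * 3"
      by (intro mult_mono) (auto simp: V_def)
    then show ?case
      by (simp add: W_eq)
  qed
  have int_W: "integrable M (\<lambda>x. exp (- m x) * V x)"
    using W_le by (intro integrable_const_bound[where B = "3 * exp 1"]) (auto simp: W_eq V_def abs_mult)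
  have pull_out: "AE x in M. real_cond_exp M G (\<lambda>x. exp (- m x) * V x) x
      = exp (- m x) * real_cond_exp M G V x"
    using m_meas by (intro real_cond_exp_mult int_W) auto
  have "AE x in M. real_cond_exp M G V x \<le> real_cond_exp M G (\<lambda>x. 1 + T x) x"
    using V_le by (intro real_cond_exp_mono int_V) (auto intro: int_T)
  moreover have "AE x in M. real_cond_exp M G (\<lambda>x. 1 + T x) x
      = real_cond_exp M G (\<lambda>x. 1) x + real_cond_exp M G T x"
    by (intro real_cond_exp_add int_T) simp
  moreover have "AE x in M. real_cond_exp M G (\<lambda>x. 1) x = 1"
    by (intro real_cond_exp_F_meas) auto
  ultimately show "AE x in M.
      real_cond_exp M G (\<lambda>x. exp (Y x - m x - inverse (l x) * (Y x)\<^sup>2)) x \<le> 1"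
    unfolding W_eq using pull_out m_T
  proof eventually_elim
    case (elim x)
    then have "real_cond_exp M G V x \<le> 1 + m x"
      by simp
    also have "\<dots> \<le> exp (m x)"
      by (rule exp_ge_add_one_self)
    finally have "exp (- m x) * real_cond_exp M G V x \<le> exp (- m x) * exp (m x)"
      by simp
    with elim show ?case
      by (simp flip: exp_add)
  qed
qed

section \<open>From one step to the supermartingale\<close>

text \<open>
  Induction on the later time: the tower property moves the one-step inequality at time \<open>n\<close>
  down to the earlier \<open>\<sigma>\<close>-field.
\<close>
lemma supermartingale_onI_step:
  assumes "prob_space M" and F: "filtration (space M) F" and sub: "\<And>n. subalgebra M (F n)"
    and meas: "\<And>n. X n \<in> borel_measurable (F n)" and int: "\<And>n. integrable M (X n)"
    and step: "\<And>n. AE x in M. real_cond_exp M (F n) (X (Suc n)) x \<le> X n x"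
  shows "supermartingale_on UNIV M F X"
proof -
  interpret prob_space M by fact
  have "AE x in M. real_cond_exp M (F k) (X n) x \<le> X k x" if "k \<le> n" for k n
    using that
  proof (induction n rule: dec_induct)
    case base
    interpret finite_measure_subalgebra M "F k"
      by unfold_locales (fact sub)
    have "AE x in M. real_cond_exp M (F k) (X k) x = X k x"
      by (intro real_cond_exp_F_meas int meas)
    then show ?case
      by eventually_elim simp
  next
    case (step n)
    interpret Fk: finite_measure_subalgebra M "F k"
      by unfold_locales (fact sub)
    interpret Fn: finite_measure_subalgebra M "F n"
      by unfold_locales (fact sub)
    have kn: "subalgebra (F n) (F k)"
      using F \<open>k \<le> n\<close> by (auto simp: subalgebra_def filtration_def)
    have "AE x in M. real_cond_exp M (F k) (real_cond_exp M (F n) (X (Suc n))) x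
        = real_cond_exp M (F k) (X (Suc n)) x"
      by (intro Fk.real_cond_exp_nested_subalg sub kn int)
    moreover have "AE x in M. real_cond_exp M (F k) (real_cond_exp M (F n) (X (Suc n))) x
        \<le> real_cond_exp M (F k) (X n) x"
      by (intro Fk.real_cond_exp_mono assms(6) Fn.real_cond_exp_int int)
    ultimately show ?case
      using step.IH by eventually_elim simp
  qed
  then show ?thesis
    using assms by (simp add: supermartingale_on_def)
qed

lemma supermartingale_on_subset:
  assumes "supermartingale_on I M F X" "J \<subseteq> I"
  shows "supermartingale_on J M F X"
  using assms unfolding supermartingale_on_def by (meson subsetD)

lemma supermartingale_expectation_le:
  assumes "prob_space M" "supermartingale_on I M F X" "k \<in> I" "n \<in> I" "k \<le> n"
  shows "prob_space.expectation M (X n) \<le> prob_space.expectation M (X k)"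
proof -
  interpret prob_space M by fact
  interpret finite_measure_subalgebra M "F k"
    using assms by unfold_locales (auto simp: supermartingale_on_def)
  have int: "integrable M (X k)" "integrable M (X n)"
    and le: "AE x in M. real_cond_exp M (F k) (X n) x \<le> X k x"
    using assms by (auto simp: supermartingale_on_def)
  have "expectation (X n) = expectation (real_cond_exp M (F k) (X n))"
    using real_cond_exp_int(2)[OF int(2)] by simp
  also have "\<dots> \<le> expectation (X k)"
    by (intro integral_mono_AE real_cond_exp_int int le)
  finally show ?thesis .
qed

theorem corollary5p3:
  fixes M :: "'a measure"
    and F :: "nat \<Rightarrow> 'a measure"
    and Y \<gamma> lam \<mu> :: "nat \<Rightarrow> 'a \<Rightarrow> real"
  assumes "prob_space M"
    and "filtration (space M) F"
    and "\<And>n. subalgebra M (F n)"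
    and "\<And>n. n \<ge> 1 \<Longrightarrow> Y n \<in> borel_measurable (F n)"
    and "\<And>n. n \<ge> 1 \<Longrightarrow> \<gamma> n \<in> borel_measurable (F (n - 1))"
    and "\<And>n. n \<ge> 1 \<Longrightarrow> lam n \<in> borel_measurable (F (n - 1))"
    and "\<And>n x. n \<ge> 1 \<Longrightarrow> x \<in> space M \<Longrightarrow> 0 \<le> \<gamma> n x \<and> \<gamma> n x < 1"
    and "\<And>n x. n \<ge> 1 \<Longrightarrow> x \<in> space M \<Longrightarrow> 0 < lam n x \<and> lam n x \<le> 1 / C_const (\<gamma> n x)"
    and "\<And>n. n \<ge> 1 \<Longrightarrow> \<mu> n \<in> borel_measurable (F (n - 1))"
    and "\<And>n. n \<ge> 1 \<Longrightarrow>
           AE x in M. \<mu> n x =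
             real_cond_exp M (F (n - 1))
               (\<lambda>y. Y n y * indicator {z. - \<gamma> n z \<le> Y n z \<and> Y n z < lam n z} y) x"
  shows "(\<forall>g::real. 0 \<le> g \<and> g < 1 \<longrightarrow>
            summable (\<lambda>k. g ^ k / real (k + 2)) \<and>
            C_const g = (if g = 0 then 1 / 2 else - (g + ln (1 - g)) / g\<^sup>2))
       \<and> supermartingale_on {1..} M F
            (\<lambda>n x. exp (\<Sum>i=1..n. Y i x - \<mu> i x - inverse (lam i x) * (Y i x)\<^sup>2))
       \<and> (\<forall>n\<ge>1. prob_space.expectation M
            (\<lambda>x. exp (\<Sum>i=1..n. Y i x - \<mu> i x - inverse (lam i x) * (Y i x)\<^sup>2)) \<le> 1)"
proof -
  interpret prob_space M by fact
  define W where "W i x = exp (Y i x - \<mu> i x - inverse (lam i x) * (Y i x)\<^sup>2)" for i x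
  define Z where "Z n x = exp (\<Sum>i=1..n. Y i x - \<mu> i x - inverse (lam i x) * (Y i x)\<^sup>2)" for n x
  have Z_0: "Z 0 = (\<lambda>_. 1)"
    by (simp add: Z_def fun_eq_iff)
  have Z_Suc: "Z (Suc n) = (\<lambda>x. Z n x * W (Suc n) x)" for n
    by (simp add: Z_def W_def fun_eq_iff exp_add)
  have F_mono: "f \<in> borel_measurable (F j)" if "f \<in> borel_measurable (F i)" "i \<le> j"
    for f :: "'a \<Rightarrow> real" and i j
  proof (rule measurable_from_subalg[OF _ that(1)])
    show "subalgebra (F j) (F i)"
      using assms(2) that(2) by (auto simp: subalgebra_def filtration_def)
  qed
  have W_meas: "W (Suc n) \<in> borel_measurable (F (Suc n))" for n
  proof -
    have [measurable]: "Y (Suc n) \<in> borel_measurable (F (Suc n))"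
      "\<mu> (Suc n) \<in> borel_measurable (F (Suc n))" "lam (Suc n) \<in> borel_measurable (F (Suc n))"
      using assms(4)[of "Suc n"] F_mono[OF assms(9)[of "Suc n"], of "Suc n"]
        F_mono[OF assms(6)[of "Suc n"], of "Suc n"] by auto
    show ?thesis
      unfolding W_def by measurable
  qed
  have Z_meas: "Z n \<in> borel_measurable (F n)" for n
  proof (induction n)
    case (Suc n)
    show ?case
      unfolding Z_Suc by (intro borel_measurable_times F_mono[OF Suc.IH] W_meas) simp
  qed (simp add: Z_def)
  have W_bound: "AE x in M. W (Suc n) x \<le> 3 * exp 1"
    and W_cond: "AE x in M. real_cond_exp M (F n) (W (Suc n)) x \<le> 1" for n
    using cond_exp_compensated_factor_le_1[OF assms(1,3) measurable_from_subalg[OF assms(3,4)]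
        assms(5,6,9,7,8,10), of "Suc n"]
    by (simp_all add: W_def[abs_def])
  have Z_bound: "AE x in M. Z n x \<le> (3 * exp 1) ^ n" for n
  proof (induction n)
    case (Suc n)
    then show ?case
      using W_bound[of n]
    proof eventually_elim
      case (elim x)
      then have "Z n x * W (Suc n) x \<le> (3 * exp 1) ^ n * (3 * exp 1)"
        by (intro mult_mono) (auto simp: W_def)
      then show ?case
        by (simp add: Z_Suc mult.commute)
    qed
  qed (simp add: Z_0)
  have Z_int: "integrable M (Z n)" for n
    using Z_bound[of n] measurable_from_subalg[OF assms(3) Z_meas]
    by (intro integrable_const_bound[where B = "(3 * exp 1) ^ n"]) (auto simp: Z_def)
  have Z_step: "AE x in M. real_cond_exp M (F n) (Z (Suc n)) x \<le> Z n x" for n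
  proof -
    interpret finite_measure_subalgebra M "F n"
      by unfold_locales (fact assms(3))
    have "AE x in M. real_cond_exp M (F n) (\<lambda>x. Z n x * W (Suc n) x) x
        = Z n x * real_cond_exp M (F n) (W (Suc n)) x"
      using Z_int[of "Suc n"] measurable_from_subalg[OF assms(3) W_meas]
      by (intro real_cond_exp_mult Z_meas) (auto simp: Z_Suc)
    then show ?thesis
      using W_cond[of n] unfolding Z_Suc
    proof eventually_elim
      case (elim x)
      then have "Z n x * real_cond_exp M (F n) (W (Suc n)) x \<le> Z n x * 1"
        by (intro mult_left_mono) (auto simp: Z_def)
      with elim show ?case
        by simp
    qed
  qed
  (* Time 0 is included so that the expectations can be compared with that of Z 0 = 1. *)
  have super: "supermartingale_on UNIV M F Z"
    by (intro supermartingale_onI_step assms(1-3) Z_meas Z_int Z_step)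
  have expect: "expectation (Z n) \<le> 1" for n
    using supermartingale_expectation_le[OF assms(1) super, of 0 n] by (simp add: Z_0 prob_space)
  have "supermartingale_on {1..} M F Z"
    using super by (rule supermartingale_on_subset) simp
  with expect show ?thesis
    unfolding Z_def
    using C_const_series_sums C_const_closed_form by (auto intro: sums_summable)
qed

end
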